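(* Let $X$ be a real Banach space, let $\varphi: X\to[0,\infty)$ be a function, let $f: X\to(-\infty,\infty]$ have $\mathrm{dom}\,f\neq\emptyset$, and suppose that $(f\oplus\varphi)(x)>-\infty$ for all $x\in X$. Let $\bar x\in X$. Suppose that $\varphi$ is continuous at $w-\bar x$ for every $w\in\mathcal P(\bar x)$ and that $\mathcal P$ is inner semicompact at $\bar x$. Then $$\partial(f\oplus\varphi)(\bar x)\subset\bigcup_{\bar w\in\mathcal P(\bar x)}\Big(\partial f(\bar w)\cap[-\partial\varphi(\bar w-\bar x)]\Big).$$
   Context: $X^*$ is the dual of $X$ with pairing $\langle\cdot,\cdot\rangle$. $\mathrm{dom}\,f:=\{x\in X: f(x)<\infty\}$. The infimal convolution is $(f\oplus\varphi)(x):=\inf\{f(w)+\varphi(w-x): w\in X\}$ (note the argument $w-x$); under the standing assumptions it is real-valued. The projection at $x$ is $\mathcal P(x):=\{w\in X: f(w)+\varphi(w-x)=(f\oplus\varphi)(x)\}$. $\mathcal P$ is inner semicompact at $\bar x$ if $\mathcal P(\bar x)\ne\emptyset$ and for every sequence $\{x_k\}\subset X$ converging to $\bar x$ there is a sequence $\{w_k\}$ with each $w_k\in\mathcal P(x_k)$ that contains a subsequence converging (in norm) to some $\bar w\in\mathcal P(\bar x)$. For $g:X\to(-\infty,\infty]$, $\varepsilon\ge0$ and $\bar x\in\mathrm{dom}\,g$, the $\varepsilon$-Fréchet subdifferential is $$\widehat\partial_\varepsilon g(\bar x):=\Big\{x^*\in X^*: \liminf_{x\to\bar x}\frac{g(x)-g(\bar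 x)-\langle x^*,x-\bar x\rangle}{\|x-\bar x\|}\ge-\varepsilon\Big\}.$$ The limiting (Mordukhovich) subdifferential $\partial g(\bar x)$ is the set of all $x^*\in X^*$ for which there exist sequences $\varepsilon_k\downarrow0$, $x_k\to\bar x$ with $g(x_k)\to g(\bar x)$, and $x_k^*\in\widehat\partial_{\varepsilon_k}g(x_k)$ such that $x_k^*$ converges weak$^*$ to $x^*$. For $A\subset X^*$, $-A:=\{-x^*:x^*\in A\}$. *)

theory Defs
  imports "HOL-Analysis.Analysis"
begin

definition eff_dom :: "('a \<Rightarrow> ereal) \<Rightarrow> 'a set" where
  "eff_dom f = {x. f x < \<infinity>}"

text \<open>The argument of \<open>\<phi>\<close> is \<open>w - x\<close>, not \<open>x - w\<close>; \<open>\<phi>\<close> is not assumed to be even.\<close>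

definition inf_conv :: "('a::real_normed_vector \<Rightarrow> ereal) \<Rightarrow> ('a \<Rightarrow> real) \<Rightarrow> 'a \<Rightarrow> ereal"
    (infixl "\<oplus>\<^sub>i" 65) where
  "(f \<oplus>\<^sub>i \<phi>) x = (INF w. f w + ereal (\<phi> (w - x)))"

definition proj :: "('a::real_normed_vector \<Rightarrow> ereal) \<Rightarrow> ('a \<Rightarrow> real) \<Rightarrow> 'a \<Rightarrow> 'a set" where
  "proj f \<phi> x = {w. f w + ereal (\<phi> (w - x)) = (f \<oplus>\<^sub>i \<phi>) x}"

definition inner_semicompact ::
    "('a::real_normed_vector \<Rightarrow> 'b::real_normed_vector set) \<Rightarrow> 'a \<Rightarrow> bool" where
  "inner_semicompact P x \<longleftrightarrow>
     P x \<noteq> {} \<and>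
     (\<forall>xs. xs \<longlonglongrightarrow> x \<longrightarrow>
        (\<exists>ws. (\<forall>k. ws k \<in> P (xs k)) \<and>
              (\<exists>r w. strict_mono (r :: nat \<Rightarrow> nat) \<and> w \<in> P x \<and> (ws \<circ> r) \<longlonglongrightarrow> w)))"

text \<open>
  Both subdifferentials are empty outside the effective domain.  Functions with values in
  \<open>(-\<infinity>, \<infinity>]\<close> are represented by extended-real-valued ones; at a point of the domain of such a function
  the difference quotient involves no undefined extended real arithmetic.
\<close>

definition frechet_subdiff ::
    "real \<Rightarrow> ('a::real_normed_vector \<Rightarrow> ereal) \<Rightarrow> 'a \<Rightarrow> ('a \<Rightarrow>\<^sub>L real) set" where
  "frechet_subdiff \<epsilon> g x =
     {x'. x \<in> eff_dom g \<and>
          Liminf (at x) (\<lambda>y. (g y - g x - ereal (blinfun_apply x' (y - x))) / ereal (norm (y - x)))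
            \<ge> - ereal \<epsilon>}"

text \<open>
  For real-valued functionals the strong operator topology (pointwise convergence) is the
  weak-star topology of the dual space.
\<close>

abbreviation weak_star_topology :: "('a::real_normed_vector \<Rightarrow>\<^sub>L real) topology" where
  "weak_star_topology \<equiv> strong_operator_topology"

definition limiting_subdiff ::
    "('a::real_normed_vector \<Rightarrow> ereal) \<Rightarrow> 'a \<Rightarrow> ('a \<Rightarrow>\<^sub>L real) set" where
  "limiting_subdiff g x =
     {x'. x \<in> eff_dom g \<and>
          (\<exists>\<epsilon> xs xs'. (\<forall>k. 0 \<le> \<epsilon> k) \<and> decseq \<epsilon> \<and> \<epsilon> \<longlonglongrightarrow> 0 \<and>
             xs \<longlonglongrightarrow> x \<and> (\<lambda>k. g (xs k)) \<longlonglongrightarrow> g x \<and>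
             (\<forall>k. xs' k \<in> frechet_subdiff (\<epsilon> k) g (xs k)) \<and>
             limitin weak_star_topology xs' x' sequentially)}"

end

theory Submission
  imports Defs
begin

text \<open>
  Let \<open>w \<in> proj f \<phi> x\<close>, so that \<open>w\<close> attains the infimum that defines \<open>(f \<oplus>\<^sub>i \<phi>) x\<close>.  A nearby value
  \<open>(f \<oplus>\<^sub>i \<phi>) y\<close> can be bounded from above by testing that infimum in two ways: with the point
  \<open>w + (y - x)\<close>, which keeps the argument of \<open>\<phi>\<close> equal to \<open>w - x\<close>, or with \<open>w\<close> itself, which keeps
  the argument of \<open>f\<close>.  Since equality holds at \<open>y = x\<close>, the increment of \<open>f \<oplus>\<^sub>i \<phi>\<close> at \<open>x\<close> is dominated
  by the increment of \<open>f\<close> at \<open>w\<close> along the same direction, and by the increment of \<open>\<phi>\<close> at \<open>w - x\<close> along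
  the opposite direction.  Hence an \<open>\<epsilon>\<close>-subgradient of \<open>f \<oplus>\<^sub>i \<phi>\<close> at \<open>x\<close> is one of \<open>f\<close> at \<open>w\<close>, and its
  negative is one of \<open>\<phi>\<close> at \<open>w - x\<close>; both follow from \<open>frechet_subdiff_reflect\<close>.

  For a limiting subgradient, take the approximating points \<open>x\<^sub>k\<close>.  Inner semicompactness yields
  \<open>w\<^sub>k \<in> proj f \<phi> x\<^sub>k\<close> converging along a subsequence to some \<open>w \<in> proj f \<phi> xbar\<close>, and the
  \<open>\<epsilon>\<^sub>k\<close>-subgradients at \<open>x\<^sub>k\<close> are transferred to \<open>w\<^sub>k\<close> and \<open>w\<^sub>k - x\<^sub>k\<close> as above.  What remains is the
  convergence of function values: that of \<open>\<phi> (w\<^sub>k - x\<^sub>k)\<close> is the continuity of \<open>\<phi>\<close> at \<open>w - xbar\<close>, and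
  \<open>f w\<^sub>k = (f \<oplus>\<^sub>i \<phi>) x\<^sub>k - \<phi> (w\<^sub>k - x\<^sub>k)\<close> then converges as well.
\<close>

text \<open>
  Subgradients pass from \<open>g\<close> to any \<open>h\<close> whose increments dominate those of \<open>g\<close> in corresponding
  directions.  The sign \<open>s\<close> covers both the same (\<open>s = 1\<close>) and the opposite (\<open>s = -1\<close>) direction.
  Since \<open>v \<mapsto> x + s *\<^sub>R (v - p)\<close> is an isometry carrying \<open>p\<close> to \<open>x\<close>, the denominators of the two
  difference quotients agree.
\<close>

lemma frechet_subdiff_reflect:
  fixes g h :: "'a::real_normed_vector \<Rightarrow> ereal" and s :: real
  assumes x': "x' \<in> frechet_subdiff \<epsilon> g x"
    and p: "p \<in> eff_dom h"
    and s: "\<bar>s\<bar> = 1"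
    and le: "\<And>v. g (x + s *\<^sub>R (v - p)) - g x \<le> h v - h p"
  shows "s *\<^sub>R x' \<in> frechet_subdiff \<epsilon> h p"
proof -
  define T where "T v = x + s *\<^sub>R (v - p)" for v
  have norm_T: "norm (T v - x) = norm (v - p)" for v
    using s by (simp add: T_def)
  have "(T \<longlongrightarrow> T p) (at p)"
    unfolding T_def by (intro tendsto_intros)
  then have "(T \<longlongrightarrow> x) (at p)"
    by (simp add: T_def)
  moreover have "\<forall>\<^sub>F v in at p. T v \<in> UNIV \<and> T v \<noteq> x"
    unfolding eventually_at_filter using s by (auto simp: T_def)
  ultimately have T: "filterlim T (at x) (at p)"
    by (simp add: filterlim_at)
  let ?G = "\<lambda>y. (g y - g x - ereal (blinfun_apply x' (y - x))) / ereal (norm (y - x))"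
  let ?H = "\<lambda>v. (h v - h p - ereal (blinfun_apply (s *\<^sub>R x') (v - p))) / ereal (norm (v - p))"
  have GH: "?G (T v) \<le> ?H v" if "v \<noteq> p" for v
  proof -
    have "blinfun_apply x' (T v - x) = blinfun_apply (s *\<^sub>R x') (v - p)"
      by (simp add: T_def blinfun.scaleR_right blinfun.scaleR_left)
    moreover have "g (T v) - g x \<le> h v - h p"
      unfolding T_def by (rule le)
    ultimately show ?thesis
      using that unfolding norm_T
      by (metis ereal_divide_right_mono ereal_less(2) ereal_minus_mono order_refl
          right_minus_eq zero_less_norm_iff)
  qed
  have G: "- ereal \<epsilon> \<le> Liminf (at x) ?G"
    using x' by (simp add: frechet_subdiff_def)
  have "- ereal \<epsilon> \<le> Liminf (at p) ?H"
    unfolding le_Liminf_iff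
  proof (intro allI impI)
    fix c assume "c < - ereal \<epsilon>"
    with G have "\<forall>\<^sub>F y in at x. c < ?G y"
      unfolding le_Liminf_iff by blast
    with T have "\<forall>\<^sub>F v in at p. c < ?G (T v)"
      by (rule eventually_compose_filterlim[rotated])
    moreover have "\<forall>\<^sub>F v in at p. v \<noteq> p"
      by (simp add: eventually_at_filter)
    ultimately show "\<forall>\<^sub>F v in at p. c < ?H v"
      by eventually_elim (use GH in \<open>blast intro: less_le_trans\<close>)
  qed
  then show ?thesis
    using p by (simp add: frechet_subdiff_def)
qed

lemma inf_conv_le: "(f \<oplus>\<^sub>i \<phi>) x \<le> f w + ereal (\<phi> (w - x))"
  unfolding inf_conv_def by (rule INF_lower) simp

lemma inf_conv_eq_if_proj:
  "w \<in> proj f \<phi> x \<Longrightarrow> (f \<oplus>\<^sub>i \<phi>) x = f w + ereal (\<phi> (w - x))"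
  by (simp add: proj_def)

lemma eff_dom_if_proj:
  assumes "w \<in> proj f \<phi> x" "x \<in> eff_dom (f \<oplus>\<^sub>i \<phi>)"
  shows "w \<in> eff_dom f"
  using assms by (auto simp: eff_dom_def inf_conv_eq_if_proj)

text \<open>
  The infimum at \<open>x + (v - w)\<close> is tested with \<open>v\<close>, so that the summand \<open>\<phi> (w - x)\<close> cancels.
\<close>

lemma frechet_subdiff_inf_conv_left:
  assumes w: "w \<in> proj f \<phi> x" and fw: "f w \<noteq> -\<infinity>"
    and x': "x' \<in> frechet_subdiff \<epsilon> (f \<oplus>\<^sub>i \<phi>) x"
  shows "x' \<in> frechet_subdiff \<epsilon> f w"
proof -
  have dom: "w \<in> eff_dom f"
    using w x' by (auto simp: frechet_subdiff_def intro: eff_dom_if_proj)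
  then obtain a where a: "f w = ereal a"
    using fw by (cases "f w") (auto simp: eff_dom_def)
  have "1 *\<^sub>R x' \<in> frechet_subdiff \<epsilon> f w"
  proof (rule frechet_subdiff_reflect[OF x' dom])
    fix v
    have "(f \<oplus>\<^sub>i \<phi>) (x + 1 *\<^sub>R (v - w)) \<le> f v + ereal (\<phi> (w - x))"
      using inf_conv_le[of f \<phi> "x + (v - w)" v] by (simp add: algebra_simps)
    then have "(f \<oplus>\<^sub>i \<phi>) (x + 1 *\<^sub>R (v - w)) - (f \<oplus>\<^sub>i \<phi>) x
        \<le> f v + ereal (\<phi> (w - x)) - (f w + ereal (\<phi> (w - x)))"
      unfolding inf_conv_eq_if_proj[OF w] by (intro ereal_minus_mono) auto
    also have "\<dots> = f v - f w"
      by (cases "f v") (auto simp: a)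
    finally show "(f \<oplus>\<^sub>i \<phi>) (x + 1 *\<^sub>R (v - w)) - (f \<oplus>\<^sub>i \<phi>) x \<le> f v - f w" .
  qed simp
  then show ?thesis by simp
qed

text \<open>
  The infimum at \<open>w - u\<close> is tested with \<open>w\<close>, so that the summand \<open>f w\<close> cancels.  Moving \<open>u\<close> away from
  \<open>w - x\<close> moves \<open>w - u\<close> away from \<open>x\<close> in the opposite direction, whence the change of sign.
\<close>

lemma frechet_subdiff_inf_conv_right:
  assumes w: "w \<in> proj f \<phi> x" and fw: "f w \<noteq> -\<infinity>"
    and x': "x' \<in> frechet_subdiff \<epsilon> (f \<oplus>\<^sub>i \<phi>) x"
  shows "- x' \<in> frechet_subdiff \<epsilon> (\<lambda>u. ereal (\<phi> u)) (w - x)"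
proof -
  have "w \<in> eff_dom f"
    using w x' by (auto simp: frechet_subdiff_def intro: eff_dom_if_proj)
  then obtain a where a: "f w = ereal a"
    using fw by (cases "f w") (auto simp: eff_dom_def)
  have "(-1) *\<^sub>R x' \<in> frechet_subdiff \<epsilon> (\<lambda>u. ereal (\<phi> u)) (w - x)"
  proof (rule frechet_subdiff_reflect[OF x'])
    fix u
    have "(f \<oplus>\<^sub>i \<phi>) (x + (-1) *\<^sub>R (u - (w - x))) \<le> f w + ereal (\<phi> u)"
      using inf_conv_le[of f \<phi> "x - (u - (w - x))" w] by (simp add: algebra_simps)
    then have "(f \<oplus>\<^sub>i \<phi>) (x + (-1) *\<^sub>R (u - (w - x))) - (f \<oplus>\<^sub>i \<phi>) x
        \<le> f w + ereal (\<phi> u) - (f w + ereal (\<phi> (w - x)))"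
      unfolding inf_conv_eq_if_proj[OF w] by (intro ereal_minus_mono) auto
    then show "(f \<oplus>\<^sub>i \<phi>) (x + (-1) *\<^sub>R (u - (w - x))) - (f \<oplus>\<^sub>i \<phi>) x
        \<le> ereal (\<phi> u) - ereal (\<phi> (w - x))"
      by (simp add: a)
  qed (simp_all add: eff_dom_def)
  then show ?thesis by simp
qed

lemma limitin_weak_star_uminus:
  assumes "limitin weak_star_topology xs' x' F"
  shows "limitin weak_star_topology (\<lambda>k. - xs' k) (- x') F"
proof -
  have "continuous_map weak_star_topology weak_star_topology (\<lambda>x' :: 'a \<Rightarrow>\<^sub>L real. - x')"
    unfolding continuous_on_strong_operator_topo_iff_coordinatewise blinfun.minus_left
    using continuous_map_minus[OF strong_operator_topology_continuous_evaluation] by blast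
  then show ?thesis
    using continuous_map_limit[OF _ assms] by (simp add: comp_def)
qed

lemma limiting_subdiffI:
  assumes "x \<in> eff_dom g"
    and "\<And>k. 0 \<le> \<epsilon> k" "decseq \<epsilon>" "\<epsilon> \<longlonglongrightarrow> 0"
    and "xs \<longlonglongrightarrow> x" "(\<lambda>k. g (xs k)) \<longlonglongrightarrow> g x"
    and "\<And>k. xs' k \<in> frechet_subdiff (\<epsilon> k) g (xs k)"
    and "limitin weak_star_topology xs' x' sequentially"
  shows "x' \<in> limiting_subdiff g x"
  using assms unfolding limiting_subdiff_def by blast

theorem proposition5p7:
  fixes \<phi> :: "'a::banach \<Rightarrow> real"
    and f :: "'a \<Rightarrow> ereal"
    and xbar :: 'a
  assumes phi_nonneg: "\<And>x. 0 \<le> \<phi> x"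
    and f_not_MInf: "\<And>x. f x \<noteq> -\<infinity>"
    and dom_nonempty: "eff_dom f \<noteq> {}"
    and conv_not_MInf: "\<And>x. (f \<oplus>\<^sub>i \<phi>) x > -\<infinity>"
    and phi_cont: "\<And>w. w \<in> proj f \<phi> xbar \<Longrightarrow> isCont \<phi> (w - xbar)"
    and semicompact: "inner_semicompact (proj f \<phi>) xbar"
  shows "limiting_subdiff (f \<oplus>\<^sub>i \<phi>) xbar \<subseteq>
    (\<Union>w \<in> proj f \<phi> xbar.
       limiting_subdiff f w \<inter> uminus ` limiting_subdiff (\<lambda>x. ereal (\<phi> x)) (w - xbar))"
proof
  fix x' assume "x' \<in> limiting_subdiff (f \<oplus>\<^sub>i \<phi>) xbar"
  then obtain \<epsilon> xs xs' where dom: "xbar \<in> eff_dom (f \<oplus>\<^sub>i \<phi>)"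
    and eps: "\<And>k. 0 \<le> \<epsilon> k" "decseq \<epsilon>" "\<epsilon> \<longlonglongrightarrow> 0"
    and xs: "xs \<longlonglongrightarrow> xbar" and val: "(\<lambda>k. (f \<oplus>\<^sub>i \<phi>) (xs k)) \<longlonglongrightarrow> (f \<oplus>\<^sub>i \<phi>) xbar"
    and xs': "\<And>k. xs' k \<in> frechet_subdiff (\<epsilon> k) (f \<oplus>\<^sub>i \<phi>) (xs k)"
    and lim: "limitin weak_star_topology xs' x' sequentially"
    unfolding limiting_subdiff_def by blast
  from semicompact xs obtain ws r w where ws: "\<And>k. ws k \<in> proj f \<phi> (xs k)"
    and r: "strict_mono (r :: nat \<Rightarrow> nat)" and w: "w \<in> proj f \<phi> xbar"
    and ws_lim: "(ws \<circ> r) \<longlonglongrightarrow> w"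
    unfolding inner_semicompact_def by blast
  have eps_r: "\<And>k. 0 \<le> (\<epsilon> \<circ> r) k" "decseq (\<epsilon> \<circ> r)" "(\<epsilon> \<circ> r) \<longlonglongrightarrow> 0"
    using eps r by (auto simp: decseq_def strict_mono_less_eq intro: LIMSEQ_subseq_LIMSEQ)
  have lim_r: "limitin weak_star_topology (xs' \<circ> r) x' sequentially"
    using r lim by (rule limitin_subsequence)
  have diff_lim: "(\<lambda>k. ws (r k) - xs (r k)) \<longlonglongrightarrow> w - xbar"
    using tendsto_diff[OF ws_lim LIMSEQ_subseq_LIMSEQ[OF xs r]] by (simp add: comp_def)
  have phi_lim: "(\<lambda>k. ereal (\<phi> (ws (r k) - xs (r k)))) \<longlonglongrightarrow> ereal (\<phi> (w - xbar))"
    using isCont_tendsto_compose[OF phi_cont[OF w] diff_lim] by simp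
  have f_eq: "f v = (f \<oplus>\<^sub>i \<phi>) x - ereal (\<phi> (v - x))" if "v \<in> proj f \<phi> x" for v x
    unfolding inf_conv_eq_if_proj[OF that] by (cases "f v") auto
  have "(\<lambda>k. (f \<oplus>\<^sub>i \<phi>) (xs (r k)) - ereal (\<phi> (ws (r k) - xs (r k))))
      \<longlonglongrightarrow> (f \<oplus>\<^sub>i \<phi>) xbar - ereal (\<phi> (w - xbar))"
    using LIMSEQ_subseq_LIMSEQ[OF val r] phi_lim
    by (intro tendsto_diff_ereal_general) (auto simp: comp_def)
  then have f_lim: "(\<lambda>k. f ((ws \<circ> r) k)) \<longlonglongrightarrow> f w"
    by (simp add: f_eq[OF ws] f_eq[OF w])
  have "x' \<in> limiting_subdiff f w"
  proof (rule limiting_subdiffI[OF _ eps_r ws_lim f_lim _ lim_r])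
    show "w \<in> eff_dom f"
      using w dom by (rule eff_dom_if_proj)
    show "(xs' \<circ> r) k \<in> frechet_subdiff ((\<epsilon> \<circ> r) k) f ((ws \<circ> r) k)" for k
      unfolding comp_def by (rule frechet_subdiff_inf_conv_left[OF ws f_not_MInf xs'])
  qed
  moreover have "- x' \<in> limiting_subdiff (\<lambda>x. ereal (\<phi> x)) (w - xbar)"
  proof (rule limiting_subdiffI[OF _ eps_r diff_lim phi_lim _ limitin_weak_star_uminus[OF lim_r]])
    show "w - xbar \<in> eff_dom (\<lambda>x. ereal (\<phi> x))"
      by (simp add: eff_dom_def)
    show "- (xs' \<circ> r) k
        \<in> frechet_subdiff ((\<epsilon> \<circ> r) k) (\<lambda>x. ereal (\<phi> x)) (ws (r k) - xs (r k))" for k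
      unfolding comp_def by (rule frechet_subdiff_inf_conv_right[OF ws f_not_MInf xs'])
  qed
  then have "x' \<in> uminus ` limiting_subdiff (\<lambda>x. ereal (\<phi> x)) (w - xbar)"
    by (intro image_eqI[where x = "- x'"]) simp_all
  ultimately show "x' \<in> (\<Union>w \<in> proj f \<phi> xbar.
       limiting_subdiff f w \<inter> uminus ` limiting_subdiff (\<lambda>x. ereal (\<phi> x)) (w - xbar))"
    using w by blast
qed

end
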